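(* There exists an abelian $6$-power free morphism $h:\Sigma^*\to\Sigma^*$ over the binary alphabet $\Sigma=\{a,b\}$ with an infinite fixed point $\Omega_1\in\Sigma^{\mathbb{N}}$ such that: (i) $aaaaa$ is not a factor of $\Omega_1$; (ii) $bb$ is not a factor of $\Omega_1$; (iii) $\Omega_1$ is abelian $6$-power free.
   Context: $\Sigma^*$ is the free monoid of finite words over $\Sigma$, with empty word $\epsilon$. A morphism is a monoid homomorphism $h:\Sigma^*\to\Sigma^*$; it extends to infinite words letter by letter, and an infinite word $\Omega$ is a fixed point of $h$ if $h(\Omega)=\Omega$. A factor of a word is a contiguous finite subword. The Parikh vector $\psi(u)$ of a finite word $u$ records the number of occurrences of each letter in $u$. A word $u$ (finite or infinite) is abelian $k$-power free if whenever $u=xv_1\cdots v_ky$ with $\psi(v_1)=\cdots=\psi(v_k)$, one has $v_1=\cdots=v_k=\epsilon$. A morphism $h$ is abelian $n$-power free if $h(u)$ is abelian $n$-power free for every abelian $n$-power free word $u$. *)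

theory Defs
  imports Main "HOL-Library.Omega_Words_Fun"
begin

text \<open>
  Finite words are lists. Infinite words are the functions \<open>nat \<Rightarrow> 'a\<close> of
  \<open>Omega_Words_Fun\<close>, where \<open>u \<frown> y\<close> prepends the finite word \<open>u\<close> to the infinite word \<open>y\<close>.
\<close>

datatype letter = letter_a | letter_b

definition is_morphism :: "('a list \<Rightarrow> 'b list) \<Rightarrow> bool" where
  "is_morphism h \<longleftrightarrow> h [] = [] \<and> (\<forall>u v. h (u @ v) = h u @ h v)"

definition parikh :: "'a list \<Rightarrow> 'a \<Rightarrow> nat" where
  "parikh u = (\<lambda>c. count_list u c)"

text \<open>The list \<open>vs\<close> consists of the blocks \<open>v\<^sub>1, \<dots>, v\<^sub>k\<close>, all with the same Parikh vector.\<close>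

definition abelian_equivalent_blocks :: "'a list list \<Rightarrow> bool" where
  "abelian_equivalent_blocks vs \<longleftrightarrow> (\<forall>v \<in> set vs. \<forall>w \<in> set vs. parikh v = parikh w)"

definition abelian_power_free :: "nat \<Rightarrow> 'a list \<Rightarrow> bool" where
  "abelian_power_free k u \<longleftrightarrow>
     (\<forall>x vs y. u = x @ concat vs @ y \<and> length vs = k \<and> abelian_equivalent_blocks vs
        \<longrightarrow> (\<forall>v \<in> set vs. v = []))"

definition abelian_power_free_inf :: "nat \<Rightarrow> 'a word \<Rightarrow> bool" where
  "abelian_power_free_inf k \<Omega> \<longleftrightarrow>
     (\<forall>x vs y. \<Omega> = x \<frown> concat vs \<frown> y \<and> length vs = k \<and> abelian_equivalent_blocks vs
        \<longrightarrow> (\<forall>v \<in> set vs. v = []))"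

definition abelian_power_free_morphism :: "nat \<Rightarrow> ('a list \<Rightarrow> 'b list) \<Rightarrow> bool" where
  "abelian_power_free_morphism n h \<longleftrightarrow>
     is_morphism h \<and> (\<forall>u. abelian_power_free n u \<longrightarrow> abelian_power_free n (h u))"

definition is_factor_inf :: "'a list \<Rightarrow> 'a word \<Rightarrow> bool" where
  "is_factor_inf u \<Omega> \<longleftrightarrow> (\<exists>x y. \<Omega> = x \<frown> u \<frown> y)"

definition image_upto :: "('a list \<Rightarrow> 'b list) \<Rightarrow> 'a word \<Rightarrow> nat \<Rightarrow> 'b list" where
  "image_upto h \<Omega> n = concat (map (\<lambda>i. h [\<Omega> i]) [0..<n])"

text \<open>
  Morphisms may erase letters, so the letter-by-letter image \<open>h(\<Omega>\<^sub>0) h(\<Omega>\<^sub>1) \<dots>\<close> of an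
  infinite word can be finite. \<open>extend_inf h \<Omega>\<close> is meaningful only when that image is infinite,
  and a fixed point is required to have an infinite image.
\<close>

definition has_infinite_image :: "('a list \<Rightarrow> 'b list) \<Rightarrow> 'a word \<Rightarrow> bool" where
  "has_infinite_image h \<Omega> \<longleftrightarrow> (\<forall>i. \<exists>n. i < length (image_upto h \<Omega> n))"

definition extend_inf :: "('a list \<Rightarrow> 'b list) \<Rightarrow> 'a word \<Rightarrow> 'b word" where
  "extend_inf h \<Omega> = (\<lambda>i. image_upto h \<Omega> (LEAST n. i < length (image_upto h \<Omega> n)) ! i)"

definition is_fixed_point_inf :: "('a list \<Rightarrow> 'a list) \<Rightarrow> 'a word \<Rightarrow> bool" where
  "is_fixed_point_inf h \<Omega> \<longleftrightarrow> has_infinite_image h \<Omega> \<and> extend_inf h \<Omega> = \<Omega>"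

end

theory Submission
  imports Defs "HOL-Library.Sublist"
begin

text \<open>
  The morphism is \<open>a \<mapsto> abaaa\<close>, \<open>b \<mapsto> bab\<close>, and \<open>\<Omega>\<^sub>1\<close> is its fixed point starting with \<open>a\<close>.
  We use Dekking's method. The weight \<open>|u|\<^sub>a + 3 |u|\<^sub>b\<close> modulo 7 vanishes on both images, so at a
  boundary of an abelian 6-power in an image the weight of the preceding prefix is that of a proper
  prefix of \<open>abaaa\<close> or \<open>bab\<close>. The seven boundary weights form an arithmetic progression modulo 7
  that misses the residue 2, hence it is constant. The weight determines the Parikh vector of such
  a proper prefix, so every block has the Parikh vector of the image of a block of the original
  word. The matrix of the morphism has determinant 7, so these blocks form an abelian 6-power.
\<close>

section \<open>Images under the morphism and their cuts\<close>

fun img :: "letter \<Rightarrow> letter list" where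
  "img letter_a = [letter_a, letter_b, letter_a, letter_a, letter_a]"
| "img letter_b = [letter_b, letter_a, letter_b]"

definition morph :: "letter list \<Rightarrow> letter list" where
  "morph u = concat (map img u)"

lemma morph_simps [simp]:
  "morph [] = []"
  "morph (c # u) = img c @ morph u"
  "morph (u @ v) = morph u @ morph v"
  by (simp_all add: morph_def)

definition proper_prefixes :: "letter list set" where
  "proper_prefixes = {[], [letter_a], [letter_a, letter_b], [letter_a, letter_b, letter_a],
     [letter_a, letter_b, letter_a, letter_a], [letter_b], [letter_b, letter_a]}"

lemma proper_prefixesI:
  assumes "img c = p @ q" "q \<noteq> []"
  shows "p \<in> proper_prefixes"
  using assms by (cases c) (auto simp: proper_prefixes_def Cons_eq_append_conv)

lemma Nil_in_proper_prefixes: "[] \<in> proper_prefixes"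
  by (simp add: proper_prefixes_def)

text \<open>The cut of \<open>w\<close> is made at the last letter boundary not after the end of
  \<open>p\<close>. A letter whose image straddles that end stays in \<open>w2\<close>, and
  \<open>r\<close> is the part of its image already read.\<close>

lemma morph_cut:
  assumes "morph w = p @ z"
  obtains w1 w2 r where "w = w1 @ w2" "p = morph w1 @ r" "morph w2 = r @ z"
    "r \<in> proper_prefixes"
  using assms
proof (induction w arbitrary: p thesis)
  case Nil
  then show ?case using Nil_in_proper_prefixes by fastforce
next
  case (Cons c w)
  consider us where "img c = p @ us" "us \<noteq> []" | q where "p = img c @ q" "morph w = q @ z"
    using Cons.prems(2) unfolding morph_simps append_eq_append_conv2
    by (metis append_Nil append_Nil2)
  then show ?case
  proof cases
    case 1
    then have "p \<in> proper_prefixes"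
      by (rule proper_prefixesI)
    then show ?thesis
      using Cons.prems(1)[of "[]" "c # w" p] Cons.prems(2) by simp
  next
    case (2 q)
    show ?thesis
    proof (rule Cons.IH[OF _ 2(2)])
      fix w1 w2 r
      assume "w = w1 @ w2" "q = morph w1 @ r" "morph w2 = r @ z" "r \<in> proper_prefixes"
      then show thesis
        using Cons.prems(1)[of "c # w1" w2 r] 2(1) by simp
    qed
  qed
qed

text \<open>Cutting at the end of each block in turn gives the factors \<open>ws ! i\<close>; the
  remainders at its two ends account for the difference between \<open>vs ! i\<close> and the image
  of \<open>ws ! i\<close>.\<close>

lemma morph_blocks:
  assumes "morph w = r @ concat vs @ y" "r \<in> proper_prefixes"
  shows "\<exists>ws rs t. w = concat ws @ t \<and> length ws = length vs \<and>
    (\<forall>i \<le> length vs. rs i \<in> proper_prefixes) \<and>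
    (\<forall>i < length vs. rs i @ vs ! i = morph (ws ! i) @ rs (Suc i))"
proof -
  \<comment> \<open>Carrying \<open>rs 0 = r\<close> through the induction makes the remainder left
    by one block the one from which the next block starts.\<close>
  have "\<exists>ws rs t. w = concat ws @ t \<and> length ws = length vs \<and> rs 0 = r \<and>
    (\<forall>i \<le> length vs. rs i \<in> proper_prefixes) \<and>
    (\<forall>i < length vs. rs i @ vs ! i = morph (ws ! i) @ rs (Suc i))"
    using assms
  proof (induction vs arbitrary: w r)
    case Nil
    then show ?case by (intro exI[of _ "[]"] exI[of _ "\<lambda>_. r"] exI[of _ w]) simp
  next
    case (Cons v vs)
    have "morph w = (r @ v) @ concat vs @ y" using Cons.prems by simp
    then obtain w1 w2 r' where cut: "w = w1 @ w2" "r @ v = morph w1 @ r'"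
      "morph w2 = r' @ concat vs @ y" "r' \<in> proper_prefixes"
      by (rule morph_cut)
    from Cons.IH[OF cut(3,4)] obtain ws rs t where IH: "w2 = concat ws @ t"
      "length ws = length vs" "rs 0 = r'" "\<forall>i \<le> length vs. rs i \<in> proper_prefixes"
      "\<forall>i < length vs. rs i @ vs ! i = morph (ws ! i) @ rs (Suc i)"
      by blast
    have "case_nat r rs i \<in> proper_prefixes" if "i \<le> length (v # vs)" for i
      using that IH(4) Cons.prems(2) by (cases i) simp_all
    moreover have "case_nat r rs i @ (v # vs) ! i = morph ((w1 # ws) ! i) @ case_nat r rs (Suc i)"
      if "i < length (v # vs)" for i
      using that IH(3,5) cut(2) by (cases i) simp_all
    moreover have "w = concat (w1 # ws) @ t" "length (w1 # ws) = length (v # vs)"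
      using cut(1) IH(1,2) by simp_all
    ultimately show ?case
      by (intro exI[of _ "w1 # ws"] exI[of _ "case_nat r rs"] exI[of _ t]) simp
  qed
  then show ?thesis by blast
qed

section \<open>Weights modulo 7 and Parikh vectors\<close>

definition weight :: "letter list \<Rightarrow> nat" where
  "weight u = count_list u letter_a + 3 * count_list u letter_b"

lemma weight_append [simp]: "weight (u @ v) = weight u + weight v"
  by (simp add: weight_def)

lemma count_list_morph:
  "count_list (morph u) letter_a = 4 * count_list u letter_a + count_list u letter_b"
  "count_list (morph u) letter_b = count_list u letter_a + 2 * count_list u letter_b"
proof (induction u)
  case (Cons c u)
  { case 1 show ?case using Cons.IH by (cases c) simp_all }
  { case 2 show ?case using Cons.IH by (cases c) simp_all }
qed simp_all

text \<open>Each image has weight exactly 7: 4 + 3 * 1 for \<open>img letter_a\<close> and 1 + 3 * 2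
  for \<open>img letter_b\<close>.\<close>

lemma weight_morph: "weight (morph u) mod 7 = 0"
  by (simp add: weight_def count_list_morph)

lemma parikh_eq_iff:
  "parikh u = parikh v \<longleftrightarrow>
    count_list u letter_a = count_list v letter_a \<and> count_list u letter_b = count_list v letter_b"
  unfolding parikh_def fun_eq_iff by (metis letter.exhaust)

lemma parikh_eq_Nil_iff: "parikh u = parikh [] \<longleftrightarrow> u = []"
  by (cases u) (auto simp: parikh_def fun_eq_iff)

text \<open>The matrix with rows (4, 1) and (1, 2) has nonzero determinant 7, so it acts injectively
  on Parikh vectors.\<close>

lemma parikh_morph_eq_iff: "parikh (morph u) = parikh (morph v) \<longleftrightarrow> parikh u = parikh v"
  by (auto simp: parikh_eq_iff count_list_morph)

text \<open>In the order in which \<open>proper_prefixes\<close> lists them, the weights are 0, 1,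
  4, 5, 6, 3, 4.\<close>

lemma weight_proper_prefixes: "r \<in> proper_prefixes \<Longrightarrow> weight r mod 7 \<noteq> 2"
  by (auto simp: proper_prefixes_def weight_def)

text \<open>The only two distinct members with the same residue are \<open>ab\<close> and
  \<open>ba\<close>, which are anagrams.\<close>

lemma parikh_proper_prefixes:
  assumes "r \<in> proper_prefixes" "s \<in> proper_prefixes" "weight r mod 7 = weight s mod 7"
  shows "parikh r = parikh s"
  using assms by (auto simp: proper_prefixes_def weight_def parikh_eq_iff)

text \<open>As 7 is prime, \<open>g\<close> is invertible modulo 7, so the seven terms run through
  all residues.\<close>

lemma progression_mod_7_hits_2:
  fixes a g :: nat
  assumes "g mod 7 \<noteq> 0"
  shows "\<exists>i \<le> 6. (a + i * g) mod 7 = 2"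
proof -
  have residues: "\<exists>i \<in> {0, 1, 2, 3, 4, 5, 6}. (x + i * y) mod 7 = 2"
    if "x \<in> {0, 1, 2, 3, 4, 5, 6}" "y \<in> {1, 2, 3, 4, 5, 6}" for x y :: nat
    using that by (elim insertE emptyE; hypsubst; simp)
  have less_7: "k \<in> {0, 1, 2, 3, 4, 5, 6}" if "k < 7" for k :: nat
    using that by auto
  have "a mod 7 \<in> {0, 1, 2, 3, 4, 5, 6}" and "g mod 7 \<in> {1, 2, 3, 4, 5, 6}"
    using less_7[of "a mod 7"] less_7[of "g mod 7"] assms by simp_all
  from residues[OF this] obtain i
    where i: "i \<in> {0, 1, 2, 3, 4, 5, 6}" "(a mod 7 + i * (g mod 7)) mod 7 = 2" ..
  have "(a + i * g) mod 7 = (a mod 7 + i * (g mod 7)) mod 7"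
    by (rule mod_add_cong) (simp_all add: mod_mult_right_eq)
  then show ?thesis using i by (intro exI[of _ i]) auto
qed

section \<open>Preservation of abelian 6-power freeness\<close>

lemma is_morphism_morph: "is_morphism morph"
  by (simp add: is_morphism_def)

lemma abelian_power_free_morph:
  assumes free: "abelian_power_free 6 u"
  shows "abelian_power_free 6 (morph u)"
  unfolding abelian_power_free_def
proof (intro allI impI, elim conjE)
  fix x vs y
  assume eq: "morph u = x @ concat vs @ y" and len: "length vs = 6"
    and equiv: "abelian_equivalent_blocks vs"
  obtain u1 u2 r where u: "u = u1 @ u2" "morph u2 = r @ concat vs @ y" "r \<in> proper_prefixes"
    using morph_cut[OF eq] by metis
  from morph_blocks[OF u(2,3)] len obtain ws rs t where u2: "u2 = concat ws @ t"
    and lws: "length ws = 6" and rs: "\<And>i. i \<le> 6 \<Longrightarrow> rs i \<in> proper_prefixes"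
    and step: "\<And>i. i < 6 \<Longrightarrow> rs i @ vs ! i = morph (ws ! i) @ rs (Suc i)"
    by auto
  have vs: "parikh (vs ! i) = parikh (vs ! 0)" if "i < 6" for i
    using equiv that len unfolding abelian_equivalent_blocks_def by (metis nth_mem zero_less_numeral)
  define g where "g = weight (vs ! 0)"
  have weight_vs: "weight (vs ! i) = g" if "i < 6" for i
    using vs[OF that] by (simp add: parikh_eq_iff weight_def g_def)
  \<comment> \<open>Passing a block adds \<open>g\<close> modulo 7, because the image of
    \<open>ws ! i\<close> has weight 0 modulo 7.\<close>
  have progression: "i \<le> 6 \<Longrightarrow> weight (rs i) mod 7 = (weight (rs 0) + i * g) mod 7" for i
  proof (induction i)
    case (Suc i)
    have "weight (rs i) + g = weight (morph (ws ! i)) + weight (rs (Suc i))"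
      using arg_cong[OF step[of i], of weight] weight_vs[of i] Suc.prems by simp
    then have "weight (rs (Suc i)) mod 7 = (weight (rs i) + g) mod 7"
      by (metis add_0 mod_add_left_eq weight_morph)
    also have "\<dots> = (weight (rs i) mod 7 + g) mod 7"
      by (simp add: mod_add_left_eq)
    also have "\<dots> = (weight (rs 0) + i * g + g) mod 7"
      using Suc by (simp add: mod_add_left_eq)
    finally show ?case by (simp add: algebra_simps)
  qed simp
  have "(weight (rs 0) + i * g) mod 7 \<noteq> 2" if "i \<le> 6" for i
    using progression[OF that] weight_proper_prefixes[OF rs[OF that]] by simp
  \<comment> \<open>Here the exponent 6 enters: six blocks have seven boundaries, enough for a
    nonzero difference to reach the forbidden residue 2.\<close>
  then have "g mod 7 = 0"
    using progression_mod_7_hits_2[of g "weight (rs 0)"] by blast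
  then have const: "weight (rs i) mod 7 = weight (rs 0) mod 7" if "i \<le> 6" for i
    using progression[OF that] mod_mult_right_eq[of i g 7]
    by (metis add.right_neutral mod_add_right_eq mult_0_right mod_0)
  have "parikh (rs i) = parikh (rs 0)" if "i \<le> 6" for i
    using that by (intro parikh_proper_prefixes rs const) simp_all
  then have "parikh (rs (Suc i)) = parikh (rs i)" if "i < 6" for i
    using that by (metis Suc_leI less_imp_le)
  \<comment> \<open>The remainders on the two sides of \<open>step\<close> have equal Parikh vectors
    and cancel.\<close>
  then have blocks: "parikh (morph (ws ! i)) = parikh (vs ! i)" if "i < 6" for i
    using that arg_cong[OF step[OF that], of "\<lambda>v. count_list v letter_a"]
      arg_cong[OF step[OF that], of "\<lambda>v. count_list v letter_b"]
    by (simp add: parikh_eq_iff)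
  have "parikh (ws ! i) = parikh (ws ! 0)" if "i < 6" for i
    using that blocks vs parikh_morph_eq_iff by (metis zero_less_numeral)
  then have "abelian_equivalent_blocks ws"
    unfolding abelian_equivalent_blocks_def by (metis in_set_conv_nth lws)
  moreover have "u = u1 @ concat ws @ t" using u u2 by simp
  ultimately have "\<forall>w \<in> set ws. w = []"
    using free lws unfolding abelian_power_free_def by blast
  then have "parikh (vs ! i) = parikh []" if "i < 6" for i
    using blocks[OF that] that lws by (metis morph_simps(1) nth_mem)
  then show "\<forall>v \<in> set vs. v = []"
    using len by (metis in_set_conv_nth parikh_eq_Nil_iff)
qed

text \<open>Base case for the iterates: a single letter cannot meet two blocks, so some block is
  empty, and equal Parikh vectors make all of them empty.\<close>

lemma abelian_power_free_singleton:
  fixes c :: letter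
  assumes "k \<ge> 2"
  shows "abelian_power_free k [c]"
  unfolding abelian_power_free_def
proof (intro allI impI, elim conjE)
  fix x vs y
  assume eq: "[c] = x @ concat vs @ y" and len: "length vs = k"
    and equiv: "abelian_equivalent_blocks vs"
  obtain v w zs where vs: "vs = v # w # zs"
    using assms len by (cases vs; cases "tl vs") auto
  have "length (v @ w) \<le> 1"
    using arg_cong[OF eq, of length] vs by simp
  then have "v = [] \<or> w = []" by (cases v) auto
  then have "parikh u = parikh []" if "u \<in> set vs" for u
    using that equiv vs unfolding abelian_equivalent_blocks_def by (metis list.set_intros)
  then show "\<forall>v \<in> set vs. v = []" by (simp add: parikh_eq_Nil_iff)
qed

section \<open>The factors \<open>bb\<close> and \<open>aaaaa\<close> in images\<close>

text \<open>Neither image contains \<open>bb\<close>, so it straddles a boundary; only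
  \<open>bab\<close> ends in \<open>b\<close> and only \<open>bab\<close> starts with
  \<open>b\<close>.\<close>

lemma sublist_bb_morph:
  assumes "sublist [letter_b, letter_b] (morph u)"
  shows "sublist [letter_b, letter_b] u"
proof -
  from assms obtain x y where eq: "morph u = x @ [letter_b, letter_b] @ y"
    unfolding sublist_def by blast
  obtain u1 u2 r where u: "u = u1 @ u2" "morph u2 = r @ [letter_b, letter_b] @ y"
    "r \<in> proper_prefixes"
    using morph_cut[OF eq] by metis
  obtain c u3 where u2: "u2 = c # u3" using u(2) by (cases u2) auto
  have "c = letter_b \<and> morph u3 = letter_b # y"
    using u(2,3) unfolding u2 by (cases c) (auto simp: proper_prefixes_def)
  moreover from this obtain d u4 where "u3 = d # u4" by (cases u3) auto
  ultimately have "u2 = [letter_b, letter_b] @ u4"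
    using u2 by (cases d) auto
  then show ?thesis using u(1) by (auto simp: sublist_def)
qed

lemma not_sublist_aaaaa_morph:
  "\<not> sublist [letter_a, letter_a, letter_a, letter_a, letter_a] (morph u)"
proof
  assume "sublist [letter_a, letter_a, letter_a, letter_a, letter_a] (morph u)"
  then obtain x y where
    eq: "morph u = x @ [letter_a, letter_a, letter_a, letter_a, letter_a] @ y"
    unfolding sublist_def by blast
  obtain u1 u2 r where
    u: "morph u2 = r @ [letter_a, letter_a, letter_a, letter_a, letter_a] @ y"
      "r \<in> proper_prefixes"
    using morph_cut[OF eq] by metis
  obtain c u3 where u2: "u2 = c # u3" using u(1) by (cases u2) auto
  \<comment> \<open>The run can start only in \<open>abaaa\<close>, after a remainder of length 2, 3
    or 4. At most three of its letters fit there, so \<open>morph u3\<close> would start with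
    \<open>aa\<close>, but images start with \<open>ab\<close> or \<open>ba\<close>.\<close>
  have "\<exists>v. morph u3 = letter_a # letter_a # v"
    using u unfolding u2 by (cases c) (auto simp: proper_prefixes_def)
  then obtain v where v: "morph u3 = letter_a # letter_a # v" ..
  then obtain d u4 where "u3 = d # u4" by (cases u3) auto
  then show False using v by (cases d) auto
qed

section \<open>The fixed point as the limit of the iterates\<close>

definition iterate :: "nat \<Rightarrow> letter list" where
  "iterate n = (morph ^^ n) [letter_a]"

lemma iterate_simps [simp]:
  "iterate 0 = [letter_a]"
  "iterate (Suc n) = morph (iterate n)"
  by (simp_all add: iterate_def)

lemma prefix_morph: "Sublist.prefix u v \<Longrightarrow> Sublist.prefix (morph u) (morph v)"
  by (auto simp: prefix_def)

lemma length_morph: "length (morph u) \<ge> 3 * length u"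
proof (induction u)
  case (Cons c u)
  then show ?case by (cases c) simp_all
qed simp

lemma prefix_iterate_Suc: "Sublist.prefix (iterate n) (iterate (Suc n))"
  by (induction n) (simp_all add: prefix_morph)

lemma prefix_iterate: "m \<le> n \<Longrightarrow> Sublist.prefix (iterate m) (iterate n)"
  by (induction n rule: dec_induct) (blast intro: prefix_order.trans prefix_iterate_Suc)+

lemma length_iterate: "n < length (iterate n)"
proof (induction n)
  case (Suc n)
  then show ?case using length_morph[of "iterate n"] by simp
qed simp

text \<open>Position \<open>i\<close> exists in \<open>iterate i\<close> by
  \<open>length_iterate\<close>, and since the iterates form a chain of prefixes, any other iterate
  reaching \<open>i\<close> has the same letter there.\<close>

definition fixed_word :: "letter word" where
  "fixed_word i = iterate i ! i"

lemma fixed_word_nth: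
  assumes "i < length (iterate n)"
  shows "iterate n ! i = fixed_word i"
proof (cases "i \<le> n")
  case True
  then show ?thesis
    using prefix_iterate[OF True] length_iterate[of i]
    by (auto simp: fixed_word_def prefix_def nth_append)
next
  case False
  then have "Sublist.prefix (iterate n) (iterate i)" by (simp add: prefix_iterate)
  then show ?thesis
    using assms by (auto simp: fixed_word_def prefix_def nth_append)
qed

lemma subsequence_fixed_word:
  assumes "Sublist.prefix u (iterate n)"
  shows "fixed_word [0 \<rightarrow> length u] = u"
proof (rule nth_equalityI)
  fix i
  assume "i < length (fixed_word [0 \<rightarrow> length u])"
  then show "fixed_word [0 \<rightarrow> length u] ! i = u ! i"
    using assms fixed_word_nth[of i n] by (auto simp: prefix_def nth_append)
qed simp

lemma prefix_subsequence_fixed_word: "Sublist.prefix (fixed_word [0 \<rightarrow> n]) (iterate n)"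
proof -
  have "length (take n (iterate n)) = n"
    using length_iterate[of n] by simp
  then show ?thesis
    using subsequence_fixed_word[of "take n (iterate n)" n] by (simp add: take_is_prefix)
qed

lemma image_upto_morph: "image_upto morph w n = morph (w [0 \<rightarrow> n])"
  by (simp add: image_upto_def morph_def subsequence_def comp_def)

text \<open>A prefix of length \<open>n\<close> lies in \<open>iterate n\<close>, so its image is a
  prefix of \<open>iterate (Suc n)\<close> and agrees with \<open>fixed_word\<close>.\<close>

lemma is_fixed_point_inf_fixed_word: "is_fixed_point_inf morph fixed_word"
proof -
  have nth: "image_upto morph fixed_word n ! i = fixed_word i"
    if "i < length (image_upto morph fixed_word n)" for i n
  proof -
    have "Sublist.prefix (image_upto morph fixed_word n) (iterate (Suc n))"
      by (simp add: image_upto_morph prefix_morph prefix_subsequence_fixed_word)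
    then show ?thesis
      using that fixed_word_nth[of i "Suc n"] by (auto simp: prefix_def nth_append)
  qed
  have infinite: "i < length (image_upto morph fixed_word (Suc i))" for i
    using length_morph[of "fixed_word [0 \<rightarrow> Suc i]"] by (simp add: image_upto_morph)
  \<comment> \<open>Since \<open>nth\<close> covers every \<open>n\<close> whose image reaches
    \<open>i\<close>, the value chosen by \<open>LEAST\<close> is as good as any;
    \<open>infinite\<close> shows that one exists.\<close>
  have "extend_inf morph fixed_word i = fixed_word i" for i
    unfolding extend_inf_def by (rule nth, rule LeastI, rule infinite)
  then show ?thesis
    using infinite unfolding is_fixed_point_inf_def has_infinite_image_def by blast
qed

section \<open>Transfer from the iterates to the infinite word\<close>

lemma finite_part_of_fixed_word:
  assumes "fixed_word = u \<frown> y"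
  shows "\<exists>n. Sublist.prefix u (iterate n)"
  using assms prefix_subsequence_fixed_word[of "length u"] by (metis prefix_conc_length)

lemma is_factor_inf_fixed_word:
  assumes "is_factor_inf u fixed_word"
  shows "\<exists>n. sublist u (iterate n)"
proof -
  from assms obtain x y where "fixed_word = (x @ u) \<frown> y"
    by (auto simp: is_factor_inf_def)
  then obtain n where "Sublist.prefix (x @ u) (iterate n)"
    using finite_part_of_fixed_word by blast
  then show ?thesis by (auto simp: prefix_def sublist_def)
qed

lemma not_sublist_bb_iterate: "\<not> sublist [letter_b, letter_b] (iterate n)"
  by (induction n) (auto dest: sublist_bb_morph simp: sublist_Cons_right)

lemma not_sublist_aaaaa_iterate:
  "\<not> sublist [letter_a, letter_a, letter_a, letter_a, letter_a] (iterate n)"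
  by (cases n) (auto simp: not_sublist_aaaaa_morph sublist_Cons_right)

lemma abelian_power_free_iterate: "abelian_power_free 6 (iterate n)"
  by (induction n) (simp_all add: abelian_power_free_singleton abelian_power_free_morph)

lemma abelian_power_free_inf_fixed_word: "abelian_power_free_inf 6 fixed_word"
  unfolding abelian_power_free_inf_def
proof (intro allI impI, elim conjE)
  fix x vs y
  assume eq: "fixed_word = x \<frown> concat vs \<frown> y" and vs: "length vs = 6"
    "abelian_equivalent_blocks vs"
  from eq have "fixed_word = (x @ concat vs) \<frown> y" by simp
  then obtain n z where "iterate n = x @ concat vs @ z"
    using finite_part_of_fixed_word by (metis append.assoc prefixE)
  then show "\<forall>v \<in> set vs. v = []"
    using abelian_power_free_iterate[of n] vs unfolding abelian_power_free_def by blast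
qed

theorem theorem2p15:
  shows "\<exists>(h :: letter list \<Rightarrow> letter list) (\<Omega>\<^sub>1 :: letter word).
    is_morphism h \<and>
    abelian_power_free_morphism 6 h \<and>
    is_fixed_point_inf h \<Omega>\<^sub>1 \<and>
    \<not> is_factor_inf [letter_a, letter_a, letter_a, letter_a, letter_a] \<Omega>\<^sub>1 \<and>
    \<not> is_factor_inf [letter_b, letter_b] \<Omega>\<^sub>1 \<and>
    abelian_power_free_inf 6 \<Omega>\<^sub>1"
proof (intro exI conjI)
  show "is_morphism morph"
    by (rule is_morphism_morph)
  show "abelian_power_free_morphism 6 morph"
    by (simp add: abelian_power_free_morphism_def is_morphism_morph abelian_power_free_morph)
  show "is_fixed_point_inf morph fixed_word"
    by (rule is_fixed_point_inf_fixed_word)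
  show "\<not> is_factor_inf [letter_a, letter_a, letter_a, letter_a, letter_a] fixed_word"
    using is_factor_inf_fixed_word not_sublist_aaaaa_iterate by blast
  show "\<not> is_factor_inf [letter_b, letter_b] fixed_word"
    using is_factor_inf_fixed_word not_sublist_bb_iterate by blast
  show "abelian_power_free_inf 6 fixed_word"
    by (rule abelian_power_free_inf_fixed_word)
qed

end
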